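(* There exists $t_0$ such that for every integer $t\geq t_0$ and every real $p$ with $0<p<p_0(t)$, where $p_0(t)=\frac{2}{\sqrt{4t+9}-1}$, there exists a constant $\epsilon_0=\epsilon_0(p,t)>0$ (depending only on $p$ and $t$) such that the following holds: for every $0<\epsilon<\epsilon_0$, every integer $n\ge t$, and every shifted $3$-wise $t$-intersecting family $\mathcal{G}\subset 2^{[n]}$ with $\mu_p(\mathcal{G})=p^t-\epsilon$, we have $$\mu_p(\mathcal{G}\setminus\mathcal{F})<\frac{3\epsilon}{t-3}$$ for some $\mathcal{F}\in\{\mathcal{F}_0^t,\mathcal{F}_1^t\}$.
   Context: $[n]=\{1,2,\ldots,n\}$ and $2^{[n]}$ is its power set. A family $\mathcal{G}\subset 2^{[n]}$ is $3$-wise $t$-intersecting if $|G_1\cap G_2\cap G_3|\geq t$ for all $G_1,G_2,G_3\in\mathcal{G}$ (not necessarily distinct). For $0<p<1$ and $q=1-p$, the $p$-biased measure is $\mu_p(\mathcal{G})=\sum_{G\in\mathcal{G}}p^{|G|}q^{n-|G|}$. A family $\mathcal{F}\subset 2^{[n]}$ is shifted if $(F\setminus\{j\})\cup\{i\}\in\mathcal{F}$ whenever $F\in\mathcal{F}$ and $1\le i<j\le n$ satisfy $\{i,j\}\cap F=\{j\}$. For integers $0\le s\le\lfloor\frac{n-t}{3}\rfloor$, $\mathcal{F}_s^t=\mathcal{F}_s^t(n)=\{F\in 2^{[n]}: |F\cap[t+3s]|\geq t+2s\}$; thus $\mathcal{F}_1^t$ is defined only when $n\ge t+3$, and the alternative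 $\mathcal F=\mathcal{F}_1^t$ does not occur otherwise. *)

theory Defs
  imports Complex_Main
begin

text \<open>
  A family over the ground set \<open>[n] = {1..n}\<close> is a \<open>nat set set\<close> that is
  assumed to be a subset of \<open>Pow {1..n}\<close> wherever it is used.
\<close>

definition three_wise_intersecting :: "nat \<Rightarrow> 'a set set \<Rightarrow> bool" where
  "three_wise_intersecting t G \<longleftrightarrow>
     (\<forall>A\<in>G. \<forall>B\<in>G. \<forall>C\<in>G. t \<le> card (A \<inter> B \<inter> C))"

definition biased_measure :: "nat \<Rightarrow> real \<Rightarrow> nat set set \<Rightarrow> real" where
  "biased_measure n p G = (\<Sum>A\<in>G. p ^ card A * (1 - p) ^ (n - card A))"

definition shifted :: "nat \<Rightarrow> nat set set \<Rightarrow> bool" where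
  "shifted n G \<longleftrightarrow>
     (\<forall>A\<in>G. \<forall>i j. 1 \<le> i \<and> i < j \<and> j \<le> n \<and> {i, j} \<inter> A = {j} \<longrightarrow>
        (A - {j}) \<union> {i} \<in> G)"

text \<open>
  The family \<open>\<F>\<^sub>s\<^sup>t(n)\<close>. It is only meaningful for \<open>n \<ge> t\<close> and \<open>s \<le> (n - t) div 3\<close>;
  this side condition is imposed where the family is used.
\<close>

definition frankl_family :: "nat \<Rightarrow> nat \<Rightarrow> nat \<Rightarrow> nat set set" where
  "frankl_family n t s =
     {A \<in> Pow {1..n}. t + 2 * s \<le> card (A \<inter> {1..t + 3 * s})}"

definition critical_prob :: "nat \<Rightarrow> real" where
  "critical_prob t = 2 / (sqrt (4 * real t + 9) - 1)"

end

theory Submission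
  imports Defs
begin

text \<open>
  Why the theorem holds: a shifted 3-wise \<open>t\<close>-intersecting family \<open>G\<close> that is contained neither in
  \<open>\<F>\<^sub>0\<^sup>t\<close> nor in \<open>\<F>\<^sub>1\<^sup>t\<close> has measure at most \<open>9/10 * p ^ t\<close>, for \<open>t \<ge> 10000\<close>
  (\<open>measure_le_of_not_subset_frankl\<close>). Hence for \<open>\<epsilon> < p ^ t / 10\<close> the family \<open>G\<close> lies
  entirely inside one of the two, and the measure to be estimated is 0.

  The gap comes from the walk method. By shiftedness every \<open>F \<in> G\<close> lies in some \<open>\<F>\<^sub>s\<^sup>t\<close>
  (\<open>member_in_some_frankl_family\<close>), and \<open>\<F>\<^sub>s\<^sup>t\<close> has measure at most
  \<open>((t+3s) choose s) * p^(t+2s)\<close>, about \<open>p ^ t * (t p^2)^s / s!\<close>. Below the critical probability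
  \<open>t p^2\<close> is at most slightly above 1, so all \<open>s \<ge> 2\<close> together contribute about
  \<open>(exp 1 - 2) * p ^ t\<close>, and there is room to spare as long as the terms for \<open>s = 0\<close> and
  \<open>s = 1\<close> are negligible.

  They are negligible for such a \<open>G\<close>. A single member outside \<open>\<F>\<^sub>0\<^sup>t\<close> forces the members
  containing \<open>[t]\<close> to intersect pairwise beyond \<open>t\<close>, and a single member outside \<open>\<F>\<^sub>1\<^sup>t\<close> has the
  same effect beyond \<open>t + 3\<close> on the members missing just one point of \<open>[t + 3]\<close>, that point being
  in \<open>[t]\<close>. As intersecting families have measure of order \<open>p\<close>, in both cases a factor
  \<open>p \<approx> 1 / sqrt t\<close> is gained (\<open>measure_inter_frankl_0_le\<close>,
  \<open>measure_inter_frankl_1_missing_le\<close>).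
\<close>

section \<open>Domination in shifted families\<close>

text \<open>
  \<open>dominated A B\<close> says that some matching moves the positive elements of \<open>A\<close> downwards to
  distinct elements of \<open>B\<close>; counting in initial segments avoids naming the matching. The set \<open>B\<close> may
  be infinite, which spares truncating the periodic patterns below to \<open>[n]\<close>.
\<close>

definition dominated :: "nat set \<Rightarrow> nat set \<Rightarrow> bool" where
  "dominated A B \<longleftrightarrow> (\<forall>k. card (A \<inter> {1..k}) \<le> card (B \<inter> {1..k}))"

text \<open>
  If \<open>A\<close> is not already contained in \<open>B\<close>, let \<open>j\<close> be the least element of \<open>A - B\<close>. Counting
  up to \<open>j\<close> gives some \<open>i < j\<close> in \<open>B - A\<close>, and replacing \<open>j\<close> by \<open>i\<close> in \<open>A\<close> keeps the
  domination and makes \<open>A - B\<close> smaller.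
\<close>

lemma shifted_dominated_contains_member:
  assumes sh: "shifted n G" and G: "G \<subseteq> Pow {1..n}"
    and "A \<in> G" "dominated A B"
  shows "\<exists>A'\<in>G. A' \<subseteq> B"
  using assms(3,4)
proof (induction "card (A - B)" arbitrary: A rule: less_induct)
  case less
  show ?case
  proof (cases "A \<subseteq> B")
    case True
    then show ?thesis using less.prems by blast
  next
    case False
    define j where "j = (LEAST x. x \<in> A - B)"
    have jA: "j \<in> A" and jB: "j \<notin> B"
      using LeastI_ex[of "\<lambda>x. x \<in> A - B"] False unfolding j_def by auto
    have below: "x \<in> B" if "x \<in> A" "x < j" for x
      using not_less_Least[of x "\<lambda>x. x \<in> A - B"] that unfolding j_def by auto
    have An: "A \<subseteq> {1..n}" using less.prems G by auto
    then have finA: "finite A" and j1: "1 \<le> j" and jn: "j \<le> n"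
      using jA finite_subset by auto
    have "\<not> B \<inter> {1..j} \<subseteq> A \<inter> {1..j}"
    proof
      assume "B \<inter> {1..j} \<subseteq> A \<inter> {1..j}"
      then have "B \<inter> {1..j} \<subset> A \<inter> {1..j}" using jA jB j1 by auto
      then have "card (B \<inter> {1..j}) < card (A \<inter> {1..j})"
        by (intro psubset_card_mono) auto
      then show False using less.prems(2) unfolding dominated_def by (meson not_le)
    qed
    then obtain i where i: "i \<in> B" "i \<notin> A" "1 \<le> i" "i \<le> j"
      unfolding subset_iff by (meson IntE IntI atLeastAtMost_iff)
    then have ij: "i < j" using jB by (cases "i = j") auto
    define A' where "A' = (A - {j}) \<union> {i}"
    have A'G: "A' \<in> G"
      using sh less.prems(1) i ij jn jA unfolding shifted_def A'_def by auto
    have "dominated A' B"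
      unfolding dominated_def
    proof
      fix k
      show "card (A' \<inter> {1..k}) \<le> card (B \<inter> {1..k})"
      proof (cases "k < j")
        case True
        then have "A' \<inter> {1..k} \<subseteq> B \<inter> {1..k}" using below i unfolding A'_def by auto
        then show ?thesis by (intro card_mono) auto
      next
        case False
        then have "A' \<inter> {1..k} = insert i (A \<inter> {1..k} - {j})"
          using i ij unfolding A'_def by auto
        then have "card (A' \<inter> {1..k}) = Suc (card (A \<inter> {1..k} - {j}))"
          using i by simp
        also have "\<dots> = card (A \<inter> {1..k})"
          using False jA j1 by (intro card_Suc_Diff1) auto
        finally show ?thesis using less.prems(2) unfolding dominated_def by simp
      qed
    qed
    moreover have "card (A' - B) < card (A - B)"
    proof -
      have "A' - B \<subset> A - B" using jA jB i unfolding A'_def by auto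
      then show ?thesis using finA by (intro psubset_card_mono) auto
    qed
    ultimately show ?thesis using less.hyps A'G by blast
  qed
qed

text \<open>
  This is how shiftedness is exploited throughout: to contradict the intersection property it
  suffices to find three sets dominating members of \<open>G\<close> with a small common part, and such sets
  can be written down explicitly.
\<close>

lemma three_wise_intersecting_dominated:
  assumes "shifted n G" "G \<subseteq> Pow {1..n}" "three_wise_intersecting t G"
    and "A1 \<in> G" "dominated A1 B1" "A2 \<in> G" "dominated A2 B2" "A3 \<in> G" "dominated A3 B3"
    and sub: "B1 \<inter> B2 \<inter> B3 \<subseteq> S" and "finite S"
  shows "t \<le> card S"
proof -
  obtain C1 C2 C3 where C: "C1 \<in> G" "C1 \<subseteq> B1" "C2 \<in> G" "C2 \<subseteq> B2" "C3 \<in> G" "C3 \<subseteq> B3"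
    using shifted_dominated_contains_member[OF assms(1,2)] assms(4-9) by meson
  then have "t \<le> card (C1 \<inter> C2 \<inter> C3)"
    using assms(3) unfolding three_wise_intersecting_def by blast
  also have "\<dots> \<le> card S" using C sub \<open>finite S\<close> by (intro card_mono) auto
  finally show ?thesis .
qed

lemma card_inter_interval_le:
  assumes "a \<le> b"
  shows "card (A \<inter> {1..b}) \<le> card (A \<inter> {1..a}) + (b - a)"
proof -
  have "A \<inter> {1..b} \<subseteq> A \<inter> {1..a} \<union> {a<..b}" by auto
  then have "card (A \<inter> {1..b}) \<le> card (A \<inter> {1..a} \<union> {a<..b})" by (intro card_mono) auto
  also have "\<dots> \<le> card (A \<inter> {1..a}) + card {a<..b}" by (rule card_Un_le)
  finally show ?thesis by simp
qed

lemma card_inter_initial_le: "card (A \<inter> {1..k}) \<le> k"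
  using card_inter_interval_le[of 0 k A] by simp

text \<open>
  Among the sets with at most \<open>l\<close> elements in \<open>[m]\<close>, the one with the largest counts fills \<open>[l]\<close>,
  leaves a gap up to \<open>m\<close> and contains everything beyond \<open>m\<close>.
\<close>

lemma dominated_by_gap:
  assumes "card (A \<inter> {1..m}) \<le> l" "l \<le> m"
  shows "dominated A (- {l<..m})"
  unfolding dominated_def
proof
  fix k
  consider "k \<le> l" | "l < k" "k \<le> m" | "m < k" by linarith
  then show "card (A \<inter> {1..k}) \<le> card (- {l<..m} \<inter> {1..k})"
  proof cases
    case 1
    then have "- {l<..m} \<inter> {1..k} = {1..k}" by auto
    then show ?thesis using card_inter_initial_le by simp
  next
    case 2
    then have "- {l<..m} \<inter> {1..k} = {1..l}" by auto
    moreover have "card (A \<inter> {1..k}) \<le> card (A \<inter> {1..m})" using 2 by (intro card_mono) auto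
    ultimately show ?thesis using assms by simp
  next
    case 3
    then have "- {l<..m} \<inter> {1..k} = {1..l} \<union> {m<..k}" using assms(2) by auto
    moreover have "card ({1..l} \<union> {m<..k}) = l + (k - m)"
      using assms(2) by (subst card_Un_disjoint) auto
    ultimately show ?thesis using card_inter_interval_le[of m k A] assms 3 by simp
  qed
qed

text \<open>
  Beyond \<open>m\<close>, delete one residue class modulo \<open>w\<close>. The \<open>w\<close> sets for \<open>r < w\<close> have no common
  element, yet each of them contains \<open>w - 1\<close> of any \<open>w\<close> consecutive positions beyond \<open>m\<close>.
\<close>

definition periodic_tail :: "nat \<Rightarrow> nat \<Rightarrow> nat \<Rightarrow> nat set" where
  "periodic_tail m w r = {x. m < x \<and> (x - (m + 1)) mod w \<noteq> r}"

text \<open>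
  The deleted class meets the first \<open>w * s + j + 1\<close> positions beyond \<open>m\<close> at most \<open>s + 1\<close> times, because
  \<open>x \<mapsto> (x - (m + 1)) div w\<close> is injective on it.
\<close>

lemma card_periodic_tail_ge:
  assumes "j < w"
  shows "(w - 1) * s + j \<le> card (periodic_tail m w r \<inter> {1..m + 1 + w * s + j})"
proof -
  let ?I = "{m<..m + 1 + w * s + j}"
  let ?T = "periodic_tail m w r"
  have "card (?I - ?T) \<le> card {..s}"
  proof (rule card_inj_on_le)
    show "inj_on (\<lambda>x. (x - (m + 1)) div w) (?I - ?T)"
    proof (rule inj_onI)
      fix x y assume x: "x \<in> ?I - ?T" and y: "y \<in> ?I - ?T"
        and eq: "(x - (m + 1)) div w = (y - (m + 1)) div w"
      have "(x - (m + 1)) mod w = (y - (m + 1)) mod w"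
        using x y by (auto simp: periodic_tail_def)
      then have "x - (m + 1) = y - (m + 1)" using eq by (metis div_mult_mod_eq)
      then show "x = y" using x y by auto
    qed
    show "(\<lambda>x. (x - (m + 1)) div w) ` (?I - ?T) \<subseteq> {..s}"
    proof
      fix y assume "y \<in> (\<lambda>x. (x - (m + 1)) div w) ` (?I - ?T)"
      then obtain x where y: "y = (x - (m + 1)) div w" and x: "x - (m + 1) \<le> w * s + j" by auto
      have "y \<le> (w * s + j) div w" unfolding y using x by (rule div_le_mono)
      also have "\<dots> = s" using assms by simp
      finally show "y \<in> {..s}" by simp
    qed
  qed simp
  then have "card (?I - ?T) \<le> s + 1" by simp
  moreover have "card ?I = card (?I \<inter> ?T) + card (?I - ?T)"
    by (rule card_Int_Diff) simp
  moreover have "?I \<inter> ?T = ?T \<inter> {1..m + 1 + w * s + j}"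
    by (auto simp: periodic_tail_def)
  moreover have "w * s = (w - 1) * s + s" using assms by (cases w) auto
  ultimately show ?thesis by simp
qed

text \<open>
  It suffices to control the count of \<open>F\<close> once in each period: \<open>j\<close> positions after a checkpoint it
  has grown by at most \<open>j\<close>, and by \<open>card_periodic_tail_ge\<close> the tail keeps up with that whichever
  class \<open>r\<close> is deleted.
\<close>

lemma dominated_by_periodic_tail:
  assumes D: "dominated F D" and "0 < w"
    and F: "\<And>s. card (F \<inter> {1..m + 1 + w * s}) \<le> card (D \<inter> {1..m}) + (w - 1) * s"
  shows "dominated F (D \<inter> {1..m} \<union> periodic_tail m w r)" (is "dominated F ?B")
  unfolding dominated_def
proof
  fix k
  show "card (F \<inter> {1..k}) \<le> card (?B \<inter> {1..k})"
  proof (cases "k \<le> m")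
    case True
    then have "D \<inter> {1..k} \<subseteq> ?B \<inter> {1..k}" by auto
    then have "card (D \<inter> {1..k}) \<le> card (?B \<inter> {1..k})" by (intro card_mono) auto
    then show ?thesis using D unfolding dominated_def by (meson le_trans)
  next
    case False
    define s j where "s = (k - (m + 1)) div w" and "j = (k - (m + 1)) mod w"
    have k: "k = m + 1 + w * s + j" and j: "j < w"
      using False \<open>0 < w\<close> by (auto simp: s_def j_def)
    have "card (F \<inter> {1..k}) \<le> card (F \<inter> {1..m + 1 + w * s}) + j"
      using card_inter_interval_le[of "m + 1 + w * s" k F] k by simp
    also have "\<dots> \<le> card (D \<inter> {1..m}) + card (periodic_tail m w r \<inter> {1..k})"
      using F[of s] card_periodic_tail_ge[OF j, of s m r] k by simp
    also have "\<dots> = card (D \<inter> {1..m} \<union> periodic_tail m w r \<inter> {1..k})"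
      by (subst card_Un_disjoint) (auto simp: periodic_tail_def)
    also have "D \<inter> {1..m} \<union> periodic_tail m w r \<inter> {1..k} = ?B \<inter> {1..k}"
      using False by auto
    finally show ?thesis .
  qed
qed

lemma dominated_UNIV: "dominated F UNIV"
  unfolding dominated_def using card_inter_initial_le by simp

text \<open>
  Frankl's walk lemma. A member outside all of these families would be dominated by each of the
  three sets that consist of \<open>[t - 1]\<close> and, from \<open>t\<close> on, two of the three residue classes
  modulo 3. These have only \<open>[t - 1]\<close> in common.
\<close>

lemma member_in_some_frankl_family:
  assumes "shifted n G" "G \<subseteq> Pow {1..n}" "three_wise_intersecting t G"
    and "1 \<le> t" "F \<in> G"
  shows "\<exists>s. F \<in> frankl_family n t s"
proof (rule ccontr)
  assume "\<not> ?thesis"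
  then have few: "card (F \<inter> {1..t + 3 * s}) < t + 2 * s" for s
    using assms(2,5) by (auto simp: frankl_family_def not_le)
  have "dominated F (UNIV \<inter> {1..t - 1} \<union> periodic_tail (t - 1) 3 r)" for r
  proof (rule dominated_by_periodic_tail[OF dominated_UNIV])
    show "card (F \<inter> {1..t - 1 + 1 + 3 * s})
        \<le> card (UNIV \<inter> {1..t - 1}) + (3 - 1) * s" for s
      using few[of s] \<open>1 \<le> t\<close> by simp
  qed simp
  note dom = this
  let ?B = "\<lambda>r. UNIV \<inter> {1..t - 1} \<union> periodic_tail (t - 1) 3 r"
  have "?B 0 \<inter> ?B 1 \<inter> ?B 2 \<subseteq> {1..t - 1}"
  proof
    fix x assume x: "x \<in> ?B 0 \<inter> ?B 1 \<inter> ?B 2"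
    have "y mod 3 = 0 \<or> y mod 3 = 1 \<or> y mod 3 = 2" for y :: nat by presburger
    from this[of "x - (t - 1 + 1)"] show "x \<in> {1..t - 1}"
      using x unfolding periodic_tail_def by (elim disjE) simp_all
  qed
  then have "t \<le> card {1..t - 1}"
    using three_wise_intersecting_dominated
      [OF assms(1-3) \<open>F \<in> G\<close> dom[of 0] \<open>F \<in> G\<close> dom[of 1] \<open>F \<in> G\<close> dom[of 2]] by blast
  then show False using \<open>1 \<le> t\<close> by simp
qed

text \<open>
  The two-set version of the walk lemma, relative to a fixed third member \<open>A\<close>. When \<open>D\<close>, \<open>D1\<close> and
  \<open>D2\<close> share fewer than \<open>t\<close> points of \<open>[m]\<close>, the part of \<open>F\<close> beyond \<open>m\<close> must behave like a
  member of a shifted intersecting family: otherwise it could be pushed both onto the positions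
  at even and onto those at odd distance from \<open>m\<close>, and these are disjoint.
\<close>

lemma member_above_diagonal:
  assumes "shifted n G" "G \<subseteq> Pow {1..n}" "three_wise_intersecting t G"
    and "A \<in> G" "dominated A D" "F \<in> G" "dominated F D1" "dominated F D2"
    and size: "card (F \<inter> {1..m}) \<le> c" "c \<le> card (D1 \<inter> {1..m})" "c \<le> card (D2 \<inter> {1..m})"
    and small: "card (D \<inter> D1 \<inter> D2 \<inter> {1..m}) < t"
  shows "\<exists>s. s < card (F \<inter> {m<..m + 1 + 2 * s})"
proof (rule ccontr)
  assume "\<not> ?thesis"
  then have few: "card (F \<inter> {m<..m + 1 + 2 * s}) \<le> s" for s by (auto simp: not_less)
  have bound: "card (F \<inter> {1..m + 1 + 2 * s}) \<le> c + (2 - 1) * s" for s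
  proof -
    have "F \<inter> {1..m + 1 + 2 * s} = F \<inter> {1..m} \<union> F \<inter> {m<..m + 1 + 2 * s}" by auto
    then have "card (F \<inter> {1..m + 1 + 2 * s})
        \<le> card (F \<inter> {1..m}) + card (F \<inter> {m<..m + 1 + 2 * s})"
      by (simp add: card_Un_le)
    then show ?thesis using few[of s] size(1) by simp
  qed
  have d1: "dominated F (D1 \<inter> {1..m} \<union> periodic_tail m 2 0)"
    by (rule dominated_by_periodic_tail[OF \<open>dominated F D1\<close>])
      (simp, rule order_trans[OF bound], use size(2) in simp)
  have d2: "dominated F (D2 \<inter> {1..m} \<union> periodic_tail m 2 1)"
    by (rule dominated_by_periodic_tail[OF \<open>dominated F D2\<close>])
      (simp, rule order_trans[OF bound], use size(3) in simp)
  have disjoint: "periodic_tail m 2 0 \<inter> periodic_tail m 2 1 = {}"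
    by (auto simp: periodic_tail_def)
  have "(D1 \<inter> {1..m} \<union> periodic_tail m 2 0) \<inter> (D2 \<inter> {1..m} \<union> periodic_tail m 2 1)
      \<subseteq> D1 \<inter> D2 \<inter> {1..m}"
  proof
    fix x
    assume x: "x \<in> (D1 \<inter> {1..m} \<union> periodic_tail m 2 0) \<inter> (D2 \<inter> {1..m} \<union> periodic_tail m 2 1)"
    then have "x \<le> m" using disjoint by (auto simp: periodic_tail_def)
    then have "x \<notin> periodic_tail m 2 r" for r by (simp add: periodic_tail_def)
    then show "x \<in> D1 \<inter> D2 \<inter> {1..m}" using x by simp
  qed
  then have "D \<inter> (D1 \<inter> {1..m} \<union> periodic_tail m 2 0) \<inter> (D2 \<inter> {1..m} \<union> periodic_tail m 2 1)
      \<subseteq> D \<inter> D1 \<inter> D2 \<inter> {1..m}" by blast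
  then have "t \<le> card (D \<inter> D1 \<inter> D2 \<inter> {1..m})"
    by (rule three_wise_intersecting_dominated
        [OF assms(1-3) \<open>A \<in> G\<close> \<open>dominated A D\<close> \<open>F \<in> G\<close> d1 \<open>F \<in> G\<close> d2]) simp
  then show False using small by simp
qed

section \<open>Union bounds for the biased measure\<close>

text \<open>
  The value is \<open>p ^ card K\<close> if \<open>K\<close> lies in \<open>[n]\<close> and 0 otherwise. In the first case expand the
  product over \<open>i \<in> [n]\<close> of \<open>p + g i\<close>, where \<open>g\<close> is 0 on \<open>K\<close> and \<open>1 - p\<close> elsewhere: the
  subsets not containing \<open>K\<close> contribute 0.
\<close>

lemma biased_measure_superset_le:
  assumes p: "0 \<le> p" "p \<le> 1" and "finite K"
  shows "biased_measure n p {A \<in> Pow {1..n}. K \<subseteq> A} \<le> p ^ card K"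
proof (cases "K \<subseteq> {1..n}")
  case True
  let ?g = "\<lambda>i. if i \<in> K then 0 else 1 - p"
  have g: "p ^ card A * prod ?g ({1..n} - A)
      = (if K \<subseteq> A then p ^ card A * (1 - p) ^ (n - card A) else 0)"
    if "A \<in> Pow {1..n}" for A
  proof (cases "K \<subseteq> A")
    case True
    then have "prod ?g ({1..n} - A) = prod (\<lambda>_. 1 - p) ({1..n} - A)"
      by (intro prod.cong) auto
    also have "\<dots> = (1 - p) ^ (n - card A)"
      using that finite_subset[of A "{1..n}"] by (simp add: card_Diff_subset)
    finally show ?thesis using True by simp
  next
    case False
    then have "prod ?g ({1..n} - A) = 0"
      using \<open>K \<subseteq> {1..n}\<close> by (intro prod_zero) auto
    then show ?thesis using False by simp
  qed
  have "biased_measure n p {A \<in> Pow {1..n}. K \<subseteq> A}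
      = (\<Sum>A\<in>Pow {1..n}. if K \<subseteq> A then p ^ card A * (1 - p) ^ (n - card A) else 0)"
    unfolding biased_measure_def by (rule sum.inter_filter) simp
  also have "\<dots> = (\<Sum>A\<in>Pow {1..n}. (\<Prod>i\<in>A. p) * prod ?g ({1..n} - A))"
    by (rule sum.cong[OF refl]) (simp only: g prod_constant)
  also have "\<dots> = (\<Prod>i\<in>{1..n}. p + ?g i)"
    by (rule prod_add[symmetric]) simp
  also have "\<dots> = (\<Prod>i\<in>{1..n}. if i \<in> K then p else 1)"
    by (intro prod.cong) auto
  also have "\<dots> = (\<Prod>i\<in>{i \<in> {1..n}. i \<in> K}. p)"
    by (rule prod.inter_filter[symmetric]) simp
  also have "{i \<in> {1..n}. i \<in> K} = K" using True by auto
  finally show ?thesis by simp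
next
  case False
  then have none: "{A \<in> Pow {1..n}. K \<subseteq> A} = {}" by auto
  show ?thesis unfolding none biased_measure_def using p by simp
qed

lemma biased_measure_UN_le:
  assumes p: "0 \<le> p" "p \<le> 1" and "finite I"
    and H: "\<And>i. i \<in> I \<Longrightarrow> H i \<subseteq> Pow {1..n}" and cover: "G \<subseteq> (\<Union>i\<in>I. H i)"
  shows "biased_measure n p G \<le> (\<Sum>i\<in>I. biased_measure n p (H i))"
  using \<open>finite I\<close> H cover
proof (induction I arbitrary: G)
  case empty
  then show ?case by (simp add: biased_measure_def)
next
  case (insert i I)
  let ?w = "\<lambda>A. p ^ card A * (1 - p) ^ (n - card A)"
  have w: "0 \<le> ?w A" for A using p by simp
  have Hi: "finite (H i)" using insert.prems(1)[of i] finite_subset by fastforce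
  have "G \<subseteq> Pow {1..n}" using insert.prems by fastforce
  then have "finite G" by (rule finite_subset) simp
  then have "sum ?w G = sum ?w (G \<inter> H i) + sum ?w (G - H i)"
    by (rule sum.Int_Diff)
  also have "sum ?w (G \<inter> H i) \<le> sum ?w (H i)"
    using Hi w by (intro sum_mono2) auto
  also have "sum ?w (G - H i) \<le> (\<Sum>i\<in>I. biased_measure n p (H i))"
  proof -
    have "biased_measure n p (G - H i) \<le> (\<Sum>i\<in>I. biased_measure n p (H i))"
    proof (rule insert.IH)
      show "H j \<subseteq> Pow {1..n}" if "j \<in> I" for j using insert.prems(1)[of j] that by simp
      show "G - H i \<subseteq> (\<Union>j\<in>I. H j)" using insert.prems(2) by auto
    qed
    then show ?thesis unfolding biased_measure_def .
  qed
  finally show ?case using insert.hyps by (simp add: biased_measure_def)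
qed

lemma biased_measure_heavy_le:
  fixes p :: real
  assumes p: "0 \<le> p" "p \<le> 1" and C: "finite C" and S: "finite S" "C \<inter> S = {}"
  shows "biased_measure n p {A \<in> Pow {1..n}. C \<subseteq> A \<and> k \<le> card (A \<inter> S)}
    \<le> real (card S choose k) * p ^ (card C + k)"
proof -
  let ?\<L> = "{L. L \<subseteq> S \<and> card L = k}"
  have "biased_measure n p {A \<in> Pow {1..n}. C \<subseteq> A \<and> k \<le> card (A \<inter> S)}
      \<le> (\<Sum>L\<in>?\<L>. biased_measure n p {A \<in> Pow {1..n}. C \<union> L \<subseteq> A})"
  proof (rule biased_measure_UN_le[OF p])
    show "finite ?\<L>" using S by simp
    show "{A \<in> Pow {1..n}. C \<subseteq> A \<and> k \<le> card (A \<inter> S)}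
        \<subseteq> (\<Union>L\<in>?\<L>. {A \<in> Pow {1..n}. C \<union> L \<subseteq> A})"
    proof
      fix A assume "A \<in> {A \<in> Pow {1..n}. C \<subseteq> A \<and> k \<le> card (A \<inter> S)}"
      then have A: "A \<in> Pow {1..n}" "C \<subseteq> A" "k \<le> card (A \<inter> S)" by simp_all
      obtain L where "L \<subseteq> A \<inter> S" "card L = k" using obtain_subset_with_card_n[OF A(3)] by blast
      then show "A \<in> (\<Union>L\<in>?\<L>. {A \<in> Pow {1..n}. C \<union> L \<subseteq> A})" using A by blast
    qed
  qed auto
  also have "\<dots> \<le> (\<Sum>L\<in>?\<L>. p ^ (card C + k))"
  proof (rule sum_mono)
    fix L assume L: "L \<in> ?\<L>"
    then have "finite L" using finite_subset[OF _ S(1)] by simp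
    moreover have "card (C \<union> L) = card C + k"
      using L S C \<open>finite L\<close> by (subst card_Un_disjoint) auto
    ultimately show "biased_measure n p {A \<in> Pow {1..n}. C \<union> L \<subseteq> A} \<le> p ^ (card C + k)"
      using biased_measure_superset_le[OF p, of "C \<union> L" n] C by simp
  qed
  also have "\<dots> = real (card S choose k) * p ^ (card C + k)"
    using n_subsets[OF S(1), of k] by simp
  finally show ?thesis .
qed

lemma biased_measure_Un_le:
  assumes "0 \<le> p" "p \<le> 1" "G \<subseteq> Pow {1..n}" "H \<subseteq> Pow {1..n}"
  shows "biased_measure n p (G \<union> H) \<le> biased_measure n p G + biased_measure n p H"
proof -
  have "biased_measure n p (G \<union> H)
      \<le> (\<Sum>b\<in>UNIV. biased_measure n p (if b then G else H))"
    by (rule biased_measure_UN_le) (use assms in \<open>auto split: if_splits\<close>)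
  then show ?thesis by (simp add: UNIV_bool)
qed

lemma biased_measure_frankl_family_le:
  assumes "0 \<le> p" "p \<le> 1"
  shows "biased_measure n p (frankl_family n t s) \<le> real ((t + 3 * s) choose s) * p ^ (t + 2 * s)"
proof -
  have "(t + 3 * s) choose (t + 2 * s) = (t + 3 * s) choose s"
    using binomial_symmetric[of s "t + 3 * s"] by (simp add: add.commute)
  then show ?thesis
    using biased_measure_heavy_le[OF assms, of "{}" "{1..t + 3 * s}" n "t + 2 * s"]
    by (simp add: frankl_family_def)
qed

lemma geometric_partial_sum_le:
  fixes r :: real assumes "0 \<le> r" "r < 1"
  shows "(\<Sum>s<n. r ^ s) \<le> 1 / (1 - r)"
  using assms by (simp add: sum_gp_strict divide_right_mono)

text \<open>
  A union bound over the time \<open>s\<close> at which the walk rises above the diagonal, with the crude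
  estimate \<open>(2s+1) choose (s+1) \<le> 2^(2s+1)\<close>. Crude suffices, because only the
  factor of order \<open>p\<close> matters.
\<close>

lemma biased_measure_above_diagonal_le:
  assumes p: "0 \<le> p" "p < 1 / 4" and C: "C \<subseteq> {1..m}" and G: "G \<subseteq> Pow {1..n}"
    and above: "\<And>A. A \<in> G \<Longrightarrow> C \<subseteq> A \<and> (\<exists>s. s < card (A \<inter> {m<..m + 1 + 2 * s}))"
  shows "biased_measure n p G \<le> p ^ card C * (2 * p / (1 - 4 * p))"
proof -
  let ?H = "\<lambda>s. {A \<in> Pow {1..n}. C \<subseteq> A \<and> s + 1 \<le> card (A \<inter> {m<..m + 1 + 2 * s})}"
  have "biased_measure n p G \<le> (\<Sum>s<n. biased_measure n p (?H s))"
  proof (rule biased_measure_UN_le)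
    show "G \<subseteq> (\<Union>s\<in>{..<n}. ?H s)"
    proof
      fix A assume A: "A \<in> G"
      then obtain s where s: "s < card (A \<inter> {m<..m + 1 + 2 * s})" using above by blast
      also have "\<dots> \<le> card {1..n}" using A G by (intro card_mono) auto
      finally have "s < n" by simp
      moreover have "A \<in> ?H s" using A G above s by simp blast
      ultimately show "A \<in> (\<Union>s\<in>{..<n}. ?H s)" by blast
    qed
  qed (use p in auto)
  also have "\<dots> \<le> (\<Sum>s<n. p ^ card C * (2 * p) * (4 * p) ^ s)"
  proof (rule sum_mono)
    fix s
    have "biased_measure n p (?H s) \<le> real ((2 * s + 1) choose (s + 1)) * p ^ (card C + (s + 1))"
      using biased_measure_heavy_le[of p C "{m<..m + 1 + 2 * s}" n "s + 1"] p C
        finite_subset[OF C] by fastforce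
    also have "\<dots> \<le> 2 ^ (2 * s + 1) * p ^ (card C + (s + 1))"
      using binomial_le_pow2[of "2 * s + 1" "s + 1"] p
      by (intro mult_right_mono) (simp_all only: of_nat_le_numeral_power_cancel_iff zero_le_power)
    also have "\<dots> = p ^ card C * (2 * p) * (4 * p) ^ s"
      by (simp add: power_add power_mult power_mult_distrib)
    finally show "biased_measure n p (?H s) \<le> p ^ card C * (2 * p) * (4 * p) ^ s" .
  qed
  also have "\<dots> = p ^ card C * (2 * p) * (\<Sum>s<n. (4 * p) ^ s)"
    by (rule sum_distrib_left[symmetric])
  also have "\<dots> \<le> p ^ card C * (2 * p) * (1 / (1 - 4 * p))"
    using p by (intro mult_left_mono geometric_partial_sum_le) auto
  finally show ?thesis by simp
qed

section \<open>The families beyond the first two\<close>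

text \<open>
  The quotient of the two binomial coefficients is
  \<open>(t+3s+3)(t+3s+2)(t+3s+1) / ((s+1)(t+2s+2)(t+2s+1))\<close>. The constant 10 is chosen generously, so
  that after clearing denominators the inequality holds coefficient by coefficient.
\<close>

lemma binomial_step_le:
  "real ((t + 3 * (s + 1)) choose (s + 1)) \<le> real ((t + 3 * s) choose s) * (real t / (real s + 1) + 10)"
proof -
  have f: "fact (t + 3 * (s + 1))
      = (real t + 3*s + 3) * (real t + 3*s + 2) * (real t + 3*s + 1) * fact (t + 3 * s)"
    by (simp add: algebra_simps eval_nat_numeral)
  have g: "fact (t + 2 * (s + 1)) = (real t + 2*s + 2) * (real t + 2*s + 1) * fact (t + 2 * s)"
    by (simp add: algebra_simps eval_nat_numeral)
  have h: "fact (s + 1) = (real s + 1) * fact s" by simp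
  have poly: "(real t + 3*s + 3) * (real t + 3*s + 2) * (real t + 3*s + 1)
      \<le> (real t + 10 * (real s + 1)) * ((real t + 2*s + 2) * (real t + 2*s + 1))"
  proof -
    have "(t + 3*s + 3) * (t + 3*s + 2) * (t + 3*s + 1)
      \<le> (t + 10 * (s + 1)) * ((t + 2*s + 2) * (t + 2*s + 1))"
      by (simp add: algebra_simps)
    then have "real ((t + 3*s + 3) * (t + 3*s + 2) * (t + 3*s + 1))
      \<le> real ((t + 10 * (s + 1)) * ((t + 2*s + 2) * (t + 2*s + 1)))"
      by (simp only: of_nat_le_iff)
    then show ?thesis
      by (simp only: of_nat_mult of_nat_add of_nat_numeral of_nat_1)
  qed
  let ?P = "(real t + 3*s + 3) * (real t + 3*s + 2) * (real t + 3*s + 1)"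
  let ?Q = "(real t + 2*s + 2) * (real t + 2*s + 1)"
  have "real ((t + 3 * (s + 1)) choose (s + 1))
      = fact (t + 3 * (s + 1)) / (fact (s + 1) * fact (t + 2 * (s + 1)))"
    using binomial_fact[of "s + 1" "t + 3 * (s + 1)", where ?'a = real]
    by (simp add: algebra_simps)
  also have "\<dots> = fact (t + 3 * s) / (fact s * fact (t + 2 * s)) * (?P / ((real s + 1) * ?Q))"
    unfolding f g h times_divide_times_eq by (simp only: mult_ac)
  also have "fact (t + 3 * s) / (fact s * fact (t + 2 * s)) = real ((t + 3 * s) choose s)"
    using binomial_fact[of s "t + 3 * s", where ?'a = real] by (simp add: algebra_simps)
  also have "?P / ((real s + 1) * ?Q) \<le> real t / (real s + 1) + 10"
  proof -
    have Q: "0 < ?Q" by (intro mult_pos_pos) auto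
    have "?P / ((real s + 1) * ?Q) \<le> ((real t + 10 * (real s + 1)) * ?Q) / ((real s + 1) * ?Q)"
      using poly Q by (intro divide_right_mono) auto
    also have "\<dots> = (real t + 10 * (real s + 1)) / (real s + 1)" using Q by simp
    also have "\<dots> = real t / (real s + 1) + 10" by (simp add: field_simps)
    finally show ?thesis .
  qed
  finally show ?thesis by (simp add: mult_left_mono)
qed

text \<open>
  The critical probability is the positive root of \<open>(t + 2) p^2 = 1 + p\<close>, where \<open>\<F>\<^sub>0\<^sup>t\<close> and
  \<open>\<F>\<^sub>1\<^sup>t\<close> have equal measure. Below it, \<open>t p^2\<close> is therefore at most slightly more than 1;
  the threshold 10000 is where \<open>sqrt (4 t)\<close> reaches 200.
\<close>

lemma critical_prob_bounds:
  assumes "10000 \<le> t" "0 < p" "p < critical_prob t"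
  shows "p < 2 / 199" "real t * p\<^sup>2 \<le> 1 + p"
proof -
  define R where "R = sqrt (4 * real t + 9)"
  have "sqrt (200\<^sup>2) \<le> R" unfolding R_def using assms(1) by (intro real_sqrt_le_mono) simp
  then have R: "200 \<le> R" by simp
  have "p * (R - 1) < 2"
    using assms(3) R unfolding critical_prob_def R_def[symmetric] by (simp add: field_simps)
  moreover have "p * 199 \<le> p * (R - 1)" using R assms(2) by (intro mult_left_mono) auto
  ultimately show "p < 2 / 199" by simp
  have "p * R < 2 + p" using \<open>p * (R - 1) < 2\<close> by (simp add: algebra_simps)
  then have "(p * R)\<^sup>2 \<le> (2 + p)\<^sup>2" using R assms(2) by (intro power_mono) auto
  moreover have "R\<^sup>2 = 4 * real t + 9" unfolding R_def by simp
  ultimately have "p\<^sup>2 * (4 * real t + 9) \<le> 4 + 4 * p + p\<^sup>2"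
    by (simp add: power_mult_distrib power2_sum)
  then have "8 * p\<^sup>2 + 4 * (real t * p\<^sup>2) \<le> 4 + 4 * p" by (simp add: algebra_simps)
  then show "real t * p\<^sup>2 \<le> 1 + p" using zero_le_power2[of p] by linarith
qed

text \<open>
  Divided by \<open>p ^ t\<close>, the term for \<open>s = k + 2\<close> is roughly \<open>(t p^2)^s / s!\<close>, so the sum is close
  to at most \<open>exp 1 - 2 < 3/4\<close>. The proof compares it with a geometric series: the first term
  is at most about 1/2, and the quotient of consecutive terms at most about 1/3 at the start and smaller
  later. This is the only estimate that is not small, and it is below 1 precisely because the
  cases \<open>s = 0\<close> and \<open>s = 1\<close> are absent.
\<close>

lemma frankl_measure_tail_le:
  assumes p: "0 < p" "p < 2 / 199" and tp: "real t * p\<^sup>2 \<le> 1 + p"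
  shows "(\<Sum>k<n. real ((t + 3 * (k + 2)) choose (k + 2)) * p ^ (t + 2 * (k + 2)))
    \<le> 4 / 5 * p ^ t"
proof -
  define a where "a k = real ((t + 3 * (k + 2)) choose (k + 2)) * p ^ (2 * (k + 2))" for k
  have p2: "p\<^sup>2 \<le> p * (2 / 199)"
    unfolding power2_eq_square using p by (intro mult_left_mono) auto
  have "a 0 \<le> 13 / 25"
  proof -
    have "real ((t + 6) choose 2) \<le> real ((t + 6) * (t + 5)) / 2"
      using of_nat_div_le_of_nat[of "(t + 6) * (t + 5)" 2, where ?'a = real] by (simp add: choose_two add.commute)
    also have "\<dots> \<le> (real t + 6)\<^sup>2 / 2" by (simp add: power2_eq_square algebra_simps)
    finally have "real ((t + 6) choose 2) * p ^ 4 \<le> (real t + 6)\<^sup>2 / 2 * p ^ 4"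
      using p by (intro mult_right_mono) auto
    moreover have "a 0 = real ((t + 6) choose 2) * p ^ 4"
    proof -
      have "0 + 2 = (2 :: nat)" "3 * 2 = (6 :: nat)" "2 * 2 = (4 :: nat)" by simp_all
      then show ?thesis by (simp only: a_def)
    qed
    ultimately have "a 0 \<le> (real t + 6)\<^sup>2 / 2 * p ^ 4" by simp
    also have "\<dots> = ((real t + 6) * p\<^sup>2)\<^sup>2 / 2"
      by (simp add: power_mult_distrib power_mult[symmetric])
    also have "((real t + 6) * p\<^sup>2)\<^sup>2 \<le> (203 / 200)\<^sup>2"
      using p p2 tp by (intro power_mono) (auto simp: algebra_simps)
    finally show ?thesis by (simp add: power2_eq_square)
  qed
  have step: "a (Suc k) \<le> a k * (7 / 20)" for k
  proof -
    have "real t / (real (k + 2) + 1) \<le> real t / 3" by (intro divide_left_mono) auto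
    then have "(real t / (real (k + 2) + 1) + 10) * p\<^sup>2 \<le> (real t / 3 + 10) * p\<^sup>2"
      by (intro mult_right_mono) auto
    also have "\<dots> = real t * p\<^sup>2 / 3 + 10 * p\<^sup>2" by (simp add: algebra_simps)
    also have "\<dots> \<le> 7 / 20" using p p2 tp by simp
    finally have r: "(real t / (real (k + 2) + 1) + 10) * p\<^sup>2 \<le> 7 / 20" .
    have "a (Suc k) = real ((t + 3 * (k + 2 + 1)) choose (k + 2 + 1)) * (p ^ (2 * (k + 2)) * p\<^sup>2)"
      by (simp add: a_def power_add[symmetric] algebra_simps del: binomial_Suc_Suc)
    also have "\<dots> \<le> real ((t + 3 * (k + 2)) choose (k + 2)) * (real t / (real (k + 2) + 1) + 10)
        * (p ^ (2 * (k + 2)) * p\<^sup>2)"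
      using p by (intro mult_right_mono binomial_step_le) simp
    also have "\<dots> = a k * ((real t / (real (k + 2) + 1) + 10) * p\<^sup>2)"
      by (simp only: a_def mult_ac)
    also have "\<dots> \<le> a k * (7 / 20)"
      using r p by (intro mult_left_mono) (simp_all add: a_def)
    finally show ?thesis .
  qed
  have "a k \<le> a 0 * (7 / 20) ^ k" for k
  proof (induction k)
    case (Suc k)
    have "a (Suc k) \<le> a 0 * (7 / 20) ^ k * (7 / 20)" using step[of k] Suc by linarith
    then show ?case by simp
  qed simp
  then have "(\<Sum>k<n. a k) \<le> (\<Sum>k<n. a 0 * (7 / 20) ^ k)" by (rule sum_mono)
  also have "\<dots> = a 0 * (\<Sum>k<n. (7 / 20) ^ k)" by (rule sum_distrib_left[symmetric])
  also have "\<dots> \<le> 13 / 25 * (1 / (1 - 7 / 20))"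
    using \<open>a 0 \<le> 13 / 25\<close>
    by (intro mult_mono geometric_partial_sum_le) (auto intro: sum_nonneg)
  also have "\<dots> = 4 / 5" by simp
  finally have "p ^ t * (\<Sum>k<n. a k) \<le> p ^ t * (4 / 5)" using p by (intro mult_left_mono) auto
  moreover have "(\<Sum>k<n. real ((t + 3 * (k + 2)) choose (k + 2)) * p ^ (t + 2 * (k + 2)))
      = p ^ t * (\<Sum>k<n. a k)"
    by (simp add: sum_distrib_left a_def power_add mult_ac del: binomial_Suc_Suc)
  ultimately show ?thesis by (simp add: mult.commute)
qed

section \<open>Members of the first two families\<close>

lemma initial_segment_subset:
  assumes "m \<le> card (F \<inter> {1..m})"
  shows "{1..m} \<subseteq> F"
proof -
  have "F \<inter> {1..m} = {1..m}" using assms by (intro card_seteq) auto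
  then show ?thesis by blast
qed

lemma card_inter_missing_le:
  assumes "i \<notin> F" "i \<in> {1..m}"
  shows "card (F \<inter> {1..m}) \<le> m - 1"
proof -
  have "card (F \<inter> {1..m}) \<le> card ({1..m} - {i})" using assms by (intro card_mono) auto
  then show ?thesis using assms by simp
qed

lemma all_but_one_subset:
  assumes "m \<le> card (F \<inter> {1..m}) + 1" "i \<notin> F" "i \<in> {1..m}"
  shows "{1..m} - {i} \<subseteq> F"
proof -
  have "F \<inter> {1..m} = {1..m} - {i}" using assms by (intro card_seteq) auto
  then show ?thesis by blast
qed

text \<open>
  The set \<open>A\<close> misses a point of \<open>[t]\<close>, hence is dominated by the complement of \<open>{t}\<close>. Two members
  containing \<open>[t]\<close> share only \<open>t - 1\<close> points of \<open>[t]\<close> with that complement, so they have to meet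
  beyond \<open>t\<close>.
  A single such \<open>A\<close> thus costs \<open>G \<inter> \<F>\<^sub>0\<^sup>t\<close> a factor of order \<open>p\<close>.
\<close>

lemma measure_inter_frankl_0_le:
  assumes p: "0 \<le> p" "p < 1 / 4" and "1 \<le> t"
    and G: "shifted n G" "G \<subseteq> Pow {1..n}" "three_wise_intersecting t G"
    and A: "A \<in> G" "A \<notin> frankl_family n t 0"
  shows "biased_measure n p (G \<inter> frankl_family n t 0) \<le> p ^ t * (2 * p / (1 - 4 * p))"
proof -
  have "card (A \<inter> {1..t}) \<le> t - 1" using A G(2) by (auto simp: frankl_family_def)
  then have domA: "dominated A (- {t - 1<..t})" by (rule dominated_by_gap) simp
  have "{1..t} \<subseteq> F \<and> (\<exists>s. s < card (F \<inter> {t<..t + 1 + 2 * s}))"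
    if F: "F \<in> G \<inter> frankl_family n t 0" for F
  proof
    show "{1..t} \<subseteq> F"
      using F by (intro initial_segment_subset) (simp add: frankl_family_def)
    have "- {t - 1<..t} \<inter> UNIV \<inter> UNIV \<inter> {1..t} = {1..t - 1}" by auto
    then have small: "card (- {t - 1<..t} \<inter> UNIV \<inter> UNIV \<inter> {1..t}) < t" using \<open>1 \<le> t\<close> by simp
    show "\<exists>s. s < card (F \<inter> {t<..t + 1 + 2 * s})"
      by (rule member_above_diagonal
          [OF G A(1) domA _ dominated_UNIV dominated_UNIV card_inter_initial_le _ _ small])
        (use F in auto)
  qed
  then show ?thesis
    using biased_measure_above_diagonal_le[OF p, of "{1..t}" t "G \<inter> frankl_family n t 0" n] G(2)
    by auto
qed

text \<open>
  The set \<open>A\<close> misses at least two points of \<open>[t + 3]\<close>, which may be moved to \<open>t + 2\<close> and \<open>t + 3\<close>. A member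
  \<open>F\<close> missing just \<open>i \<le> t\<close> can be pushed so that it misses \<open>t\<close> or so that it misses \<open>t + 1\<close>.
  Together the three sets leave \<open>t - 1\<close> points of \<open>[t + 3]\<close>. For \<open>i > t\<close> the first option is not
  available, but then \<open>F\<close> contains \<open>[t]\<close>.
\<close>

lemma measure_inter_frankl_1_missing_le:
  assumes p: "0 \<le> p" "p < 1 / 4" and i: "i \<in> {1..t}"
    and G: "shifted n G" "G \<subseteq> Pow {1..n}" "three_wise_intersecting t G"
    and A: "A \<in> G" "A \<notin> frankl_family n t 1"
  shows "biased_measure n p {F \<in> G \<inter> frankl_family n t 1. i \<notin> F}
    \<le> p ^ (t + 2) * (2 * p / (1 - 4 * p))"
proof -
  let ?D = "- {t + 1<..t + 3}" and ?D1 = "- {t - 1<..t}" and ?D2 = "- {t<..t + 1}"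
  have "card (A \<inter> {1..t + 3}) \<le> t + 1" using A G(2) by (auto simp: frankl_family_def)
  then have domA: "dominated A ?D" by (rule dominated_by_gap) simp
  have "{1..t + 3} - {i} \<subseteq> F \<and> (\<exists>s. s < card (F \<inter> {t + 3<..t + 3 + 1 + 2 * s}))"
    if F: "F \<in> {F \<in> G \<inter> frankl_family n t 1. i \<notin> F}" for F
  proof
    have FG: "F \<in> G" and iF: "i \<notin> F" using F by auto
    show "{1..t + 3} - {i} \<subseteq> F"
      using F i by (intro all_but_one_subset) (auto simp: frankl_family_def)
    have "card (F \<inter> {1..t}) \<le> t - 1" using iF i by (rule card_inter_missing_le)
    then have dom1: "dominated F ?D1" by (rule dominated_by_gap) simp
    have "card (F \<inter> {1..t + 1}) \<le> t + 1 - 1" using iF i by (intro card_inter_missing_le) auto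
    then have dom2: "dominated F ?D2" by (intro dominated_by_gap) auto
    have size: "card (F \<inter> {1..t + 3}) \<le> t + 2"
      using card_inter_missing_le[OF iF, of "t + 3"] i by simp
    have "?D1 \<inter> {1..t + 3} = {1..t + 3} - {t}" "?D2 \<inter> {1..t + 3} = {1..t + 3} - {t + 1}"
      using i by auto
    then have c: "t + 2 \<le> card (?D1 \<inter> {1..t + 3})" "t + 2 \<le> card (?D2 \<inter> {1..t + 3})"
      using i by auto
    have "?D \<inter> ?D1 \<inter> ?D2 \<inter> {1..t + 3} = {1..t - 1}" using i by auto
    then have small: "card (?D \<inter> ?D1 \<inter> ?D2 \<inter> {1..t + 3}) < t" using i by simp
    show "\<exists>s. s < card (F \<inter> {t + 3<..t + 3 + 1 + 2 * s})"
      by (rule member_above_diagonal[OF G A(1) domA FG dom1 dom2 size c small])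
  qed
  moreover have "card ({1..t + 3} - {i}) = t + 2" using i by simp
  ultimately show ?thesis
    using biased_measure_above_diagonal_le
      [OF p, of "{1..t + 3} - {i}" "t + 3" "{F \<in> G \<inter> frankl_family n t 1. i \<notin> F}" n] G(2)
    by auto
qed

section \<open>The measure gap\<close>

text \<open>
  Split \<open>G\<close> into the members containing \<open>[t]\<close>, the members of \<open>\<F>\<^sub>1\<^sup>t\<close> missing some \<open>i \<le> t\<close>, and
  the rest, whose walks reach the line only for some \<open>s \<ge> 2\<close>. The first two parts have measure
  of order \<open>p * p ^ t\<close>; for the second, the \<open>t\<close> choices of \<open>i\<close> are paid for by \<open>t p^2 \<le> 2\<close>.
\<close>

lemma measure_le_of_not_subset_frankl:
  assumes p: "0 < p" "p < 2 / 199" and tp: "real t * p\<^sup>2 \<le> 1 + p" and "1 \<le> t"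
    and G: "shifted n G" "G \<subseteq> Pow {1..n}" "three_wise_intersecting t G"
    and not0: "\<not> G \<subseteq> frankl_family n t 0" and not1: "\<not> G \<subseteq> frankl_family n t 1"
  shows "biased_measure n p G \<le> 9 / 10 * p ^ t"
proof -
  have p01: "0 \<le> p" "p \<le> 1" and p4: "p < 1 / 4" using p by auto
  define c where "c = 2 * p / (1 - 4 * p)"
  have c0: "0 \<le> c" and c: "c \<le> 1 / 40" using p unfolding c_def by (auto simp: field_simps)
  let ?G0 = "G \<inter> frankl_family n t 0"
  let ?G1 = "\<lambda>i. {F \<in> G \<inter> frankl_family n t 1. i \<notin> F}"
  let ?G2 = "G - frankl_family n t 0 - frankl_family n t 1"
  have "biased_measure n p ?G0 \<le> p ^ t * c"
    unfolding c_def using measure_inter_frankl_0_le[OF p01(1) p4 \<open>1 \<le> t\<close> G] not0 by blast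
  moreover have "biased_measure n p (\<Union>i\<in>{1..t}. ?G1 i) \<le> 2 * (p ^ t * c)"
  proof -
    have "biased_measure n p (\<Union>i\<in>{1..t}. ?G1 i) \<le> (\<Sum>i\<in>{1..t}. biased_measure n p (?G1 i))"
      by (rule biased_measure_UN_le[OF p01]) (use G(2) in auto)
    also have "\<dots> \<le> (\<Sum>i\<in>{1..t}. p ^ (t + 2) * c)"
      unfolding c_def
      using measure_inter_frankl_1_missing_le[OF p01(1) p4 _ G] not1 by (intro sum_mono) blast
    also have "\<dots> = p ^ t * (real t * p\<^sup>2 * c)" by (simp add: power_add power2_eq_square)
    also have "\<dots> \<le> p ^ t * (2 * c)"
      using tp p c0 by (intro mult_left_mono mult_right_mono) auto
    finally show ?thesis by simp
  qed
  moreover have "biased_measure n p ?G2 \<le> 4 / 5 * p ^ t"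
  proof -
    have "biased_measure n p ?G2 \<le> (\<Sum>k<n. biased_measure n p (frankl_family n t (k + 2)))"
    proof (rule biased_measure_UN_le[OF p01])
      show "frankl_family n t (k + 2) \<subseteq> Pow {1..n}" for k by (auto simp: frankl_family_def)
      show "?G2 \<subseteq> (\<Union>k\<in>{..<n}. frankl_family n t (k + 2))"
      proof
        fix F assume F: "F \<in> ?G2"
        then obtain s where s: "F \<in> frankl_family n t s"
          using member_in_some_frankl_family[OF G \<open>1 \<le> t\<close>] by blast
        have "s \<noteq> 0" "s \<noteq> 1" using F s by (metis DiffE)+
        then obtain k where k: "s = k + 2" by (metis One_nat_def add_2_eq_Suc' not0_implies_Suc)
        have "t + 2 * s \<le> card (F \<inter> {1..t + 3 * s})" using s by (simp add: frankl_family_def)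
        also have "\<dots> \<le> card {1..n}" using F G(2) by (intro card_mono) auto
        finally have "k < n" using k by simp
        then show "F \<in> (\<Union>k\<in>{..<n}. frankl_family n t (k + 2))" using s k by blast
      qed
    qed simp
    also have "\<dots> \<le> (\<Sum>k<n. real ((t + 3 * (k + 2)) choose (k + 2)) * p ^ (t + 2 * (k + 2)))"
      by (intro sum_mono biased_measure_frankl_family_le p01)
    also have "\<dots> \<le> 4 / 5 * p ^ t" by (rule frankl_measure_tail_le[OF p tp])
    finally show ?thesis .
  qed
  moreover have "biased_measure n p G \<le> biased_measure n p ?G0
      + (biased_measure n p (\<Union>i\<in>{1..t}. ?G1 i) + biased_measure n p ?G2)"
  proof -
    have "F \<in> (\<Union>i\<in>{1..t}. ?G1 i)"
      if "F \<in> G" "F \<notin> frankl_family n t 0" "F \<in> frankl_family n t 1" for F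
    proof -
      have "card (F \<inter> {1..t}) < t" using that G(2) by (auto simp: frankl_family_def)
      then have "F \<inter> {1..t} \<noteq> {1..t}" by auto
      then show ?thesis using that by blast
    qed
    then have "G = ?G0 \<union> ((\<Union>i\<in>{1..t}. ?G1 i) \<union> ?G2)" by blast
    then have "biased_measure n p G = biased_measure n p (?G0 \<union> ((\<Union>i\<in>{1..t}. ?G1 i) \<union> ?G2))"
      by (rule arg_cong)
    also have "\<dots> \<le> biased_measure n p ?G0 + biased_measure n p ((\<Union>i\<in>{1..t}. ?G1 i) \<union> ?G2)"
      by (rule biased_measure_Un_le[OF p01]) (use G(2) in auto)
    also have "biased_measure n p ((\<Union>i\<in>{1..t}. ?G1 i) \<union> ?G2)
        \<le> biased_measure n p (\<Union>i\<in>{1..t}. ?G1 i) + biased_measure n p ?G2"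
      by (rule biased_measure_Un_le[OF p01]) (use G(2) in auto)
    finally show ?thesis by simp
  qed
  \<comment> \<open>The three parts add up to at most \<open>3/40 + 4/5 < 9/10\<close>, relative to \<open>p ^ t\<close>.\<close>
  moreover have "0 \<le> p ^ t" using p by simp
  moreover have "p ^ t * c \<le> p ^ t * (1 / 40)" using c p by (intro mult_left_mono) auto
  ultimately show ?thesis by linarith
qed

text \<open>
  If \<open>F\<close> reaches the line for some \<open>s \<ge> 1\<close>, then it has at least \<open>t + 2\<close> elements, and so is all
  of \<open>[n]\<close>.
\<close>

lemma subset_frankl_0_of_small_ground:
  assumes "shifted n G" "G \<subseteq> Pow {1..n}" "three_wise_intersecting t G"
    and "1 \<le> t" "t \<le> n" "n < t + 3"
  shows "G \<subseteq> frankl_family n t 0"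
proof
  fix F assume F: "F \<in> G"
  then obtain s where s: "F \<in> frankl_family n t s"
    using member_in_some_frankl_family[OF assms(1-4)] by blast
  have Fn: "F \<subseteq> {1..n}" using F assms(2) by auto
  show "F \<in> frankl_family n t 0"
  proof (cases "s = 0")
    case False
    have "n \<le> t + 2 * s" using False assms(6) by simp
    also have "\<dots> \<le> card (F \<inter> {1..t + 3 * s})" using s by (simp add: frankl_family_def)
    also have "\<dots> \<le> card (F \<inter> {1..n})" using Fn by (intro card_mono) auto
    finally have "{1..n} \<subseteq> F" by (rule initial_segment_subset)
    then have "F \<inter> {1..t} = {1..t}" using assms(5) by auto
    then show ?thesis using Fn by (simp add: frankl_family_def)
  qed (use s in simp)
qed

theorem theorem3:
  shows "\<exists>t0::nat. \<forall>t\<ge>t0. \<forall>p::real. 0 < p \<and> p < critical_prob t \<longrightarrow>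
    (\<exists>\<epsilon>0::real. \<epsilon>0 > 0 \<and>
      (\<forall>\<epsilon>::real. \<forall>n::nat. \<forall>G::nat set set.
        0 < \<epsilon> \<and> \<epsilon> < \<epsilon>0 \<and> t \<le> n \<and>
        G \<subseteq> Pow {1..n} \<and> shifted n G \<and> three_wise_intersecting t G \<and>
        biased_measure n p G = p ^ t - \<epsilon> \<longrightarrow>
        (\<exists>s\<in>{0, 1}. s \<le> (n - t) div 3 \<and>
          biased_measure n p (G - frankl_family n t s) < 3 * \<epsilon> / (real t - 3))))"
proof (intro exI[of _ "10000 :: nat"] allI impI, elim conjE)
  fix t :: nat and p :: real
  assume t: "10000 \<le> t" and p0: "0 < p" and pc: "p < critical_prob t"
  have p: "p < 2 / 199" and tp: "real t * p\<^sup>2 \<le> 1 + p"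
    using critical_prob_bounds[OF t p0 pc] by auto
  have t1: "1 \<le> t" using t by simp
  show "\<exists>\<epsilon>0::real. \<epsilon>0 > 0 \<and>
      (\<forall>\<epsilon>::real. \<forall>n::nat. \<forall>G::nat set set.
        0 < \<epsilon> \<and> \<epsilon> < \<epsilon>0 \<and> t \<le> n \<and>
        G \<subseteq> Pow {1..n} \<and> shifted n G \<and> three_wise_intersecting t G \<and>
        biased_measure n p G = p ^ t - \<epsilon> \<longrightarrow>
        (\<exists>s\<in>{0, 1}. s \<le> (n - t) div 3 \<and>
          biased_measure n p (G - frankl_family n t s) < 3 * \<epsilon> / (real t - 3)))"
  proof (intro exI[of _ "p ^ t / 10"] conjI allI impI; (elim conjE)?)
    show "0 < p ^ t / 10" using p0 by simp
  next
    fix \<epsilon> :: real and n :: nat and G :: "nat set set"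
    assume eps: "0 < \<epsilon>" "\<epsilon> < p ^ t / 10" and tn: "t \<le> n"
      and G: "G \<subseteq> Pow {1..n}" "shifted n G" "three_wise_intersecting t G"
      and measure: "biased_measure n p G = p ^ t - \<epsilon>"
    have contained: "biased_measure n p (G - frankl_family n t s) < 3 * \<epsilon> / (real t - 3)"
      if "G \<subseteq> frankl_family n t s" for s
    proof -
      have "G - frankl_family n t s = {}" using that by blast
      then have "biased_measure n p (G - frankl_family n t s) = 0"
        by (simp only: biased_measure_def sum.empty)
      then show ?thesis using eps(1) t by simp
    qed
    have "G \<subseteq> frankl_family n t 0 \<or> G \<subseteq> frankl_family n t 1"
    proof (rule ccontr)
      assume "\<not> ?thesis"
      then have "biased_measure n p G \<le> 9 / 10 * p ^ t"
        using measure_le_of_not_subset_frankl[OF p0 p tp t1 G(2,1,3)] by blast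
      then show False using measure eps(2) by simp
    qed
    \<comment> \<open>For \<open>n < t + 3\<close> the choice \<open>s = 1\<close> is not admissible, but then \<open>s = 0\<close> always works.\<close>
    then consider "G \<subseteq> frankl_family n t 0" | "G \<subseteq> frankl_family n t 1" "t + 3 \<le> n"
      using subset_frankl_0_of_small_ground[OF G(2,1,3) t1 tn] by fastforce
    then show "\<exists>s\<in>{0, 1}. s \<le> (n - t) div 3 \<and>
        biased_measure n p (G - frankl_family n t s) < 3 * \<epsilon> / (real t - 3)"
    proof cases
      case 1
      then show ?thesis using contained[of 0] by simp
    next
      case 2
      then have "1 \<le> (n - t) div 3" by simp
      then show ?thesis using contained[of 1] 2 by blast
    qed
  qed
qed

end
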